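(* Let $G$ be the extended integer Heisenberg group. For elements $(p,c,n,k)\in G$ with $n$ odd, $$\{\,n,\ k,\ p\bmod (n,k),\ -p^2w-(n,k)(2c+p)\bmod n(n,k,p)\,\}$$ is a full system of invariants of conjugacy classes, where $w$ is any fixed solution (chosen depending only on $n,k$) of $\frac{k}{(k,n)}w\equiv 1\pmod{\frac{n}{(n,k)}}$. That is, elements $(p_1,c_1,n_1,k_1)$ and $(p_2,c_2,n_2,k_2)$ with $n_1,n_2$ odd are conjugate in $G$ if and only if $n_1=n_2=n$, $k_1=k_2=k$, $p_1\equiv p_2\pmod{(n,k)}$ and $$-p_1^2w-(n,k)(2c_1+p_1)\equiv -p_2^2w-(n,k)(2c_2+p_2)\pmod{n(n,k,p_1)}.$$
   Context: The extended integer Heisenberg group $G$ is the set $\mathbb{Z}^4$ of tuples $(p,c,n,k)$ with multiplication $$(p',c',n',k')*(p_1,c_1,n_1,k_1)=\Bigl(p'+p_1+k'n_1,\ c_1+c'+k'\tfrac{n_1(n_1-1)}{2}+n'(p_1+k'n_1),\ n_1+n',\ k_1+k'\Bigr).$$ $(a,b)$ and $(a,b,c)$ inside moduli and coefficients denote greatest common divisors of integers. *)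

theory Defs
  imports "HOL-Algebra.Group" "HOL-Number_Theory.Cong"
begin

type_synonym heis = "int \<times> int \<times> int \<times> int"

fun heis_mult :: "heis \<Rightarrow> heis \<Rightarrow> heis" where
  "heis_mult (p', c', n', k') (p1, c1, n1, k1) =
     (p' + p1 + k' * n1,
      c1 + c' + k' * (n1 * (n1 - 1) div 2) + n' * (p1 + k' * n1),
      n1 + n',
      k1 + k')"

definition ext_heisenberg :: "heis monoid" where
  "ext_heisenberg = \<lparr>carrier = UNIV, monoid.mult = heis_mult, one = (0, 0, 0, 0)\<rparr>"

definition conjugate_in :: "('a, 'b) monoid_scheme \<Rightarrow> 'a \<Rightarrow> 'a \<Rightarrow> bool" where
  "conjugate_in G x y \<longleftrightarrow>
     (\<exists>g\<in>carrier G. y = g \<otimes>\<^bsub>G\<^esub> x \<otimes>\<^bsub>G\<^esub> inv\<^bsub>G\<^esub> g)"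

lemma triangle_add:
  "(a + b) * (a + b - 1) div 2 = a * (a - 1) div 2 + b * (b - 1) div 2 + a * (b::int)"
proof -
  have e: "2 dvd x * (x - 1)" for x :: int by (cases "even x") auto
  have "(a + b) * (a + b - 1) = a * (a - 1) + b * (b - 1) + 2 * (a * b)"
    by (simp add: algebra_simps)
  then show ?thesis using e[of a] e[of b] by (simp add: div_plus_div_distrib_dvd_left)
qed

lemma group_ext_heisenberg: "group ext_heisenberg"
proof (rule groupI)
  fix x y z assume "x \<in> carrier ext_heisenberg" "y \<in> carrier ext_heisenberg"
    "z \<in> carrier ext_heisenberg"
  show "x \<otimes>\<^bsub>ext_heisenberg\<^esub> y \<otimes>\<^bsub>ext_heisenberg\<^esub> z =
        x \<otimes>\<^bsub>ext_heisenberg\<^esub> (y \<otimes>\<^bsub>ext_heisenberg\<^esub> z)"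
    by (cases x; cases y; cases z)
       (simp add: ext_heisenberg_def triangle_add, simp add: algebra_simps)
next
  fix x assume "x \<in> carrier ext_heisenberg"
  obtain p c n k where x: "x = (p, c, n, k)" by (cases x)
  let ?y = "(k * n - p, n * (p - k * n) - c + k * (n * (n - 1) div 2), - n, - k) :: heis"
  have "heis_mult ?y x = (0, 0, 0, 0)"
    by (simp add: x algebra_simps)
  then show "\<exists>y\<in>carrier ext_heisenberg.
      y \<otimes>\<^bsub>ext_heisenberg\<^esub> x = \<one>\<^bsub>ext_heisenberg\<^esub>"
    by (intro bexI[of _ ?y]) (simp_all only: ext_heisenberg_def, simp_all)
qed (auto simp: ext_heisenberg_def)

end

theory Submission
  imports Defs
begin

text \<open>
  Comparing \<open>y * g\<close> with \<open>g * x\<close> shows that, for odd \<open>n\<close>, conjugacy amounts to integers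
  \<open>s\<close>, \<open>t\<close> with \<open>p2 = p1 + t n - k s\<close> and \<open>n\<close> dividing the defect
  \<open>D = c2 - c1 - s p1 + k s (s - 1) / 2\<close>.
  For every such \<open>s\<close>, \<open>t\<close>, the difference of the fourth invariants is \<open>-2 d D\<close> modulo \<open>n e\<close>,
  where \<open>d = gcd n k\<close> and \<open>e = gcd d p1\<close>. Their equality thus only says that \<open>(n/d) e\<close>
  divides \<open>D\<close>; replacing \<open>(s, t)\<close> by \<open>(s + j n/d, t + j k/d)\<close> changes \<open>D\<close> by \<open>-j p1 n/d\<close>
  modulo \<open>n\<close>, and Bezout's identity for \<open>e\<close> provides a \<open>j\<close> that makes it divisible by \<open>n\<close>.
\<close>

lemma two_mult_triangle: "2 * (s * (s - 1) div 2) = s * (s - 1)" for s :: int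
proof -
  have "even (s * (s - 1))" by auto
  then show ?thesis by simp
qed

lemma odd_dvd_two_mult_iff: "m dvd 2 * x \<longleftrightarrow> m dvd x" if "odd m" for m x :: int
  using that by (simp add: coprime_dvd_mult_right_iff)

text \<open>Doubling removes the halving and exposes the factor \<open>k * s\<close>; the 2 is then
  cancelled because \<open>n\<close> is odd.\<close>

lemma odd_dvd_mult_triangle:
  fixes n k s :: int
  assumes "odd n" "n dvd k * s"
  shows "n dvd k * (s * (s - 1) div 2)"
proof -
  have "2 * (k * (s * (s - 1) div 2)) = k * s * (s - 1)"
    using two_mult_triangle[of s] by (simp add: algebra_simps)
  also have "n dvd \<dots>" using assms(2) by simp
  finally show ?thesis using odd_dvd_two_mult_iff[OF assms(1)] by blast
qed

text \<open>This form avoids computing inverses in the Heisenberg group.\<close>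

lemma (in group) conjugate_in_iff:
  assumes "x \<in> carrier G" "y \<in> carrier G"
  shows "conjugate_in G x y \<longleftrightarrow> (\<exists>g\<in>carrier G. y \<otimes> g = g \<otimes> x)"
  unfolding conjugate_in_def using assms by (metis inv_solve_right m_closed)

text \<open>Here \<open>q\<close>, \<open>s\<close>, \<open>t\<close> are the first, third and
  fourth coordinates of the conjugator; its second coordinate is central and cancels.\<close>

lemma conjugate_ext_heisenberg_iff:
  "conjugate_in ext_heisenberg (p1, c1, n1, k1) (p2, c2, n2, k2) \<longleftrightarrow>
    n1 = n2 \<and> k1 = k2 \<and> (\<exists>q s t. p2 = p1 + t * n1 - k1 * s \<and>
      c2 = c1 + t * (n1 * (n1 - 1) div 2) + s * (p1 + t * n1)
        - k1 * (s * (s - 1) div 2) - n1 * (q + k1 * s))"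
    (is "?L \<longleftrightarrow> ?R")
proof -
  have "?L \<longleftrightarrow> (\<exists>g. heis_mult (p2, c2, n2, k2) g = heis_mult g (p1, c1, n1, k1))"
    by (subst group.conjugate_in_iff[OF group_ext_heisenberg]) (simp_all add: ext_heisenberg_def)
  also have "\<dots> \<longleftrightarrow> (\<exists>q c s t.
      heis_mult (p2, c2, n2, k2) (q, c, s, t) = heis_mult (q, c, s, t) (p1, c1, n1, k1))"
    by (simp only: split_paired_Ex)
  also have "\<dots> \<longleftrightarrow> ?R"
    by (auto simp: algebra_simps)
  finally show ?thesis .
qed

text \<open>For odd \<open>n\<close> the triangle of \<open>n\<close> is a multiple of
  \<open>n\<close>, and \<open>q\<close> occurs only as \<open>n * q\<close>, so it absorbs all
  multiples of \<open>n\<close>.\<close>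

lemma conjugate_ext_heisenberg_odd_iff:
  assumes "odd n"
  shows "conjugate_in ext_heisenberg (p1, c1, n, k) (p2, c2, n, k) \<longleftrightarrow>
    (\<exists>s t. p2 = p1 + t * n - k * s \<and> n dvd c2 - c1 - s * p1 + k * (s * (s - 1) div 2))"
proof -
  have "n dvd 1 * (n * (n - 1) div 2)"
    using assms by (intro odd_dvd_mult_triangle) auto
  then obtain h where h: "n * (n - 1) div 2 = n * h" by auto
  have "(\<exists>q. c2 = c1 + t * (n * h) + s * (p1 + t * n)
        - k * (s * (s - 1) div 2) - n * (q + k * s)) \<longleftrightarrow>
      n dvd c2 - c1 - s * p1 + k * (s * (s - 1) div 2)" (is "?L \<longleftrightarrow> ?R") for s t
  proof
    assume ?L
    then obtain q where "c2 = c1 + t * (n * h) + s * (p1 + t * n)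
        - k * (s * (s - 1) div 2) - n * (q + k * s)" ..
    then have "c2 - c1 - s * p1 + k * (s * (s - 1) div 2) = n * (t * h + s * t - q - k * s)"
      by (simp add: algebra_simps)
    then show ?R by simp
  next
    assume ?R
    then obtain r where "c2 - c1 - s * p1 + k * (s * (s - 1) div 2) = n * r" ..
    then show ?L
      by (intro exI[of _ "t * h + s * t - k * s - r"]) (simp add: algebra_simps)
  qed
  then show ?thesis
    unfolding conjugate_ext_heisenberg_iff h by blast
qed

lemma invariant_diff_dvd:
  fixes n k d e s t w :: int
  assumes p2: "p2 = p1 + t * n - k * s"
    and e: "e dvd n" "e dvd k" "e dvd d" "e dvd p1"
    and w: "n dvd k * w - d"
  shows "n * e dvd (- (p2\<^sup>2 * w) - d * (2 * c2 + p2)) - (- (p1\<^sup>2 * w) - d * (2 * c1 + p1))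
    + 2 * d * (c2 - c1 - s * p1 + k * (s * (s - 1) div 2))"
proof -
  obtain m where "k * w - d = n * m" using w ..
  then have m: "k * w = d + n * m" by simp
  define T where "T = s * (s - 1) div 2"
  have "2 * d * (c2 - c1 - s * p1 + k * T) = 2 * d * (c2 - c1 - s * p1) + d * k * (2 * T)"
    by (simp add: algebra_simps)
  also have "2 * T = s * (s - 1)"
    unfolding T_def by (rule two_mult_triangle)
  finally have cT: "2 * d * (c2 - c1 - s * p1 + k * T)
      = 2 * d * (c2 - c1 - s * p1) + d * k * (s * (s - 1))" .
  \<comment> \<open>Every term with a factor \<open>k\<close> is arranged to contain
    \<open>k * w\<close>, ready to be replaced by \<open>d + n * m\<close>. The terms without a
    factor \<open>n\<close> then cancel against \<open>cT\<close> and the linear part.\<close>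
  have p2w: "p2\<^sup>2 * w = p1\<^sup>2 * w + t\<^sup>2 * n\<^sup>2 * w - 2 * t * n * s * (k * w)
      + k * s\<^sup>2 * (k * w) + 2 * p1 * t * n * w - 2 * p1 * s * (k * w)"
    unfolding p2 by (simp add: algebra_simps power2_eq_square)
  have "(- (p2\<^sup>2 * w) - d * (2 * c2 + p2)) - (- (p1\<^sup>2 * w) - d * (2 * c1 + p1))
      + 2 * d * (c2 - c1 - s * p1 + k * T)
    = n * (- (n * (t\<^sup>2 * w)) + 2 * t * s * d + n * (2 * t * s * m) - k * (s\<^sup>2 * m)
        - p1 * (2 * t * w) + p1 * (2 * s * m) - d * t)"
    unfolding p2w m cT by (simp add: p2 algebra_simps power2_eq_square)
  moreover have "e dvd - (n * (t\<^sup>2 * w)) + 2 * t * s * d + n * (2 * t * s * m) - k * (s\<^sup>2 * m)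
        - p1 * (2 * t * w) + p1 * (2 * s * m) - d * t"
    using e by (intro dvd_add dvd_diff) auto
  ultimately show ?thesis unfolding T_def by (metis dvd_refl mult_dvd_mono)
qed

lemma exists_conjugator_params:
  fixes n k p1 p2 c1 c2 :: int
  assumes "odd n" and p: "p2 = p1 + t * n - k * s"
    and D: "n * gcd (gcd n k) p1 dvd
      gcd n k * (c2 - c1 - s * p1 + k * (s * (s - 1) div 2))"
  shows "\<exists>s t. p2 = p1 + t * n - k * s \<and>
    n dvd c2 - c1 - s * p1 + k * (s * (s - 1) div 2)"
proof -
  define d where "d = gcd n k"
  define e where "e = gcd d p1"
  define D where "D = c2 - c1 - s * p1 + k * (s * (s - 1) div 2)"
  have "d \<noteq> 0" using assms(1) by (auto simp: d_def)
  have "d dvd n" "d dvd k" by (simp_all add: d_def)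
  then obtain n' k' where n: "n = d * n'" and k: "k = d * k'" by (auto elim!: dvdE)
  have "n * e dvd d * D" using D by (simp only: d_def e_def D_def)
  then have "d * (n' * e) dvd d * D" by (simp only: n mult.assoc)
  then have "n' * e dvd D" using \<open>d \<noteq> 0\<close> by simp
  then obtain r where r: "D = n' * (e * r)" by (metis dvdE mult.assoc)
  obtain u v where uv: "u * d + v * p1 = e"
    using bezout_int[of d p1] by (auto simp: e_def)
  \<comment> \<open>By \<open>uv\<close>,
    \<open>D - n' * j * p1 = n' * r * (e - v * p1) = n' * r * u * d\<close>, a multiple of
    \<open>n = d * n'\<close>.\<close>
  define j where "j = v * r"
  have "n dvd k * (n' * j)" by (simp add: n k)
  with assms(1) have "n dvd k * (n' * j * (n' * j - 1) div 2)" by (rule odd_dvd_mult_triangle)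
  then obtain h where h: "k * (n' * j * (n' * j - 1) div 2) = n * h" ..
  have "k * ((s + n' * j) * (s + n' * j - 1) div 2)
      = k * (s * (s - 1) div 2) + n * h + k * s * n' * j"
    unfolding triangle_add distrib_left h by simp
  then have "c2 - c1 - (s + n' * j) * p1 + k * ((s + n' * j) * (s + n' * j - 1) div 2)
      = D - n' * j * p1 + n * h + k * s * n' * j"
    by (simp add: D_def algebra_simps)
  also have "\<dots> = n * (u * r + h + k' * s * j)"
    unfolding r uv[symmetric] j_def n k by (simp add: algebra_simps)
  finally have "n dvd c2 - c1 - (s + n' * j) * p1 + k * ((s + n' * j) * (s + n' * j - 1) div 2)"
    by simp
  \<comment> \<open>The shifts of \<open>s\<close> and \<open>t\<close> compensate each other since
    \<open>k * n' = k' * n\<close>.\<close>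
  moreover have "p2 = p1 + (t + k' * j) * n - k * (s + n' * j)"
    unfolding p n k by (simp add: algebra_simps)
  ultimately show ?thesis by blast
qed

text \<open>Making \<open>w\<close> a function of \<open>n\<close> and \<open>k\<close> expresses
  that the solution is chosen independently of \<open>p\<close> and \<open>c\<close>.\<close>

theorem mainTheorem3:
  fixes w :: "int \<Rightarrow> int \<Rightarrow> int"
    and p1 c1 n1 k1 p2 c2 n2 k2 :: int
  assumes w: "\<And>n k. odd n \<Longrightarrow> [k div gcd k n * w n k = 1] (mod n div gcd n k)"
    and "odd n1" and "odd n2"
  shows "conjugate_in ext_heisenberg (p1, c1, n1, k1) (p2, c2, n2, k2) \<longleftrightarrow>
    n1 = n2 \<and> k1 = k2 \<and> [p1 = p2] (mod gcd n1 k1) \<and>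
    [- (p1\<^sup>2 * w n1 k1) - gcd n1 k1 * (2 * c1 + p1) =
     - (p2\<^sup>2 * w n1 k1) - gcd n1 k1 * (2 * c2 + p2)] (mod n1 * gcd (gcd n1 k1) p1)"
proof (cases "n1 = n2 \<and> k1 = k2")
  case False
  then show ?thesis by (auto simp: conjugate_ext_heisenberg_iff)
next
  case True
  define n k where "n = n1" and "k = k1"
  define d where "d = gcd n k"
  define e where "e = gcd d p1"
  define F where "F = (\<lambda>p c. - (p\<^sup>2 * w n k) - d * (2 * c + p))"
  define D where "D = (\<lambda>s. c2 - c1 - s * p1 + k * (s * (s - 1) div 2))"
  have "odd n" using assms(2) by (simp add: n_def)
  have "d dvd n" "d dvd k" by (simp_all add: d_def)
  moreover have "e dvd d" "e dvd p1" by (simp_all add: e_def)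
  ultimately have e: "e dvd n" "e dvd k" "e dvd d" "e dvd p1" by (blast intro: dvd_trans)+
  have "n div d dvd k div d * w n k - 1"
    using w[OF \<open>odd n\<close>, of k] by (simp add: cong_iff_dvd_diff d_def gcd.commute)
  \<comment> \<open>Scaling the congruence by \<open>d\<close> turns it into one modulo
    \<open>n\<close>, free of quotients.\<close>
  then have "d * (n div d) dvd d * (k div d * w n k - 1)" by (rule mult_dvd_mono[OF dvd_refl])
  moreover have "d * (k div d * w n k - 1) = d * (k div d) * w n k - d"
    by (simp add: algebra_simps)
  ultimately have wd: "n dvd k * w n k - d"
    using \<open>d dvd n\<close> \<open>d dvd k\<close> by simp
  have "odd (n * e)" using \<open>odd n\<close> e(1) by (auto elim: dvd_trans)
  \<comment> \<open>The left side does not mention \<open>s\<close> and \<open>t\<close>, so any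
    pair that solves the equation for \<open>p2\<close> may be used, in both directions
    below.\<close>
  have F_iff: "[F p1 c1 = F p2 c2] (mod n * e) \<longleftrightarrow> n * e dvd d * D s"
    if p: "p2 = p1 + t * n - k * s" for s t
  proof -
    have "n * e dvd F p2 c2 - F p1 c1 + 2 * (d * D s)"
      using invariant_diff_dvd[OF p e wd] by (simp add: F_def D_def mult.assoc)
    then have "n * e dvd F p2 c2 - F p1 c1 \<longleftrightarrow> n * e dvd 2 * (d * D s)"
      by (metis dvd_add_right_iff dvd_add_left_iff)
    then show ?thesis
      by (simp only: cong_iff_dvd_diff dvd_diff_commute[of _ "F p1 c1"]
        odd_dvd_two_mult_iff[OF \<open>odd (n * e)\<close>])
  qed
  have "conjugate_in ext_heisenberg (p1, c1, n, k) (p2, c2, n, k) \<longleftrightarrow>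
      (\<exists>s t. p2 = p1 + t * n - k * s \<and> n dvd D s)"
    unfolding D_def by (rule conjugate_ext_heisenberg_odd_iff[OF \<open>odd n\<close>])
  also have "\<dots> \<longleftrightarrow> [p1 = p2] (mod d) \<and> [F p1 c1 = F p2 c2] (mod n * e)" (is "?L \<longleftrightarrow> ?R")
  proof
    assume ?L
    then obtain s t where st: "p2 = p1 + t * n - k * s" "n dvd D s" by blast
    have "p1 - p2 = k * s - t * n" using st(1) by simp
    then have "[p1 = p2] (mod d)"
      using \<open>d dvd n\<close> \<open>d dvd k\<close> by (simp add: cong_iff_dvd_diff)
    moreover have "n * e dvd d * D s"
      using mult_dvd_mono[OF st(2) e(3)] by (simp add: mult.commute)
    ultimately show ?R using F_iff[OF st(1)] by simp
  next
    assume R: ?R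
    then obtain r where r: "p2 - p1 = d * r"
      by (auto simp: cong_iff_dvd_diff dvd_diff_commute[of _ p1])
    obtain u v where uv: "u * n + v * k = d" using bezout_int[of n k] by (auto simp: d_def)
    \<comment> \<open>Bezout's identity for \<open>d\<close>, scaled by \<open>r\<close>, gives a
      first pair; it need not satisfy the condition on \<open>D\<close> yet and is corrected
      afterwards.\<close>
    have p: "p2 = p1 + (r * u) * n - k * (- (r * v))"
      using r by (simp add: uv[symmetric] algebra_simps)
    from R have "n * e dvd d * D (- (r * v))" using F_iff[OF p] by simp
    then show ?L
      using exists_conjugator_params[OF \<open>odd n\<close> p] unfolding D_def d_def e_def by blast
  qed
  finally show ?thesis
    using True by (simp add: n_def k_def d_def e_def F_def)
qed

end
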